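(* Let $f,g,h:\mathbb N\to\mathbb N$ be increasing functions. If the region $\mathbb D(f,g)=\bigcup_{n\in\mathbb N}\mathcal D(n,g(n),f(n))$ is P-stable, then the region $\mathbb D(f+h,g-h)=\bigcup_{n\in\mathbb N}\mathcal D(n,g(n)-h(n),f(n)+h(n))$ is almost fully graphic, provided that (1) $f(n+k)\le f(n)+k$ for all $n,k\in\mathbb N$, and (2) $\lim_{n\to\infty}h(n)/\ln(n)=\infty$.
   Context: $\mathcal D(n,c_1,c_2)$ is the set of integer sequences $(d_1,\dots,d_n)$ with $c_1\ge d_1\ge\dots\ge d_n\ge c_2$ and $\sum_i d_i$ even. A family is fully graphic if all members are graphic (degree sequences of simple graphs), almost fully graphic if it is fully graphic after removing finitely many members. For an integer sequence $D$ of length $n$, $\mathcal G(D)$ is the set of simple graphs on labelled vertices $v_1,\dots,v_n$ with $\deg(v_i)=d_i$ (empty if some entry negative); $\mathrm{pp}(D)=\sum_{1\le i<j\le n}|\mathcal G(D+1^{-i}_{-j})|/|\mathcal G(D)|$ where $1^{-i}_{-j}$ has $-1$ in coordinates $i,j$ and $0$ elsewhere. A family is P-stable if there is a polynomial $p$ with $\mathrm{pp}(D)\le p(n)$ for every graphic member $D$ of length $n$.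
   Formalization: Added hypothesis: for all large n, if D(n, g(n)-h(n), f(n)+h(n)) is nonempty then f(n)+h(n) < n; without it the claim fails, e.g. f(n)=n, g(n)=3n, h(n)=⌊√n⌋, and the conclusion itself implies it. *)

theory Defs
  imports Complex_Main "HOL-Computational_Algebra.Polynomial"
begin

text \<open>An integer sequence \<open>D = (d\<^sub>1, \<dots>, d\<^sub>n)\<close> is an \<open>int list\<close> of length \<open>n\<close>; the vertex
  \<open>v\<^sub>i\<close> is represented by the list index \<open>i - 1\<close>.\<close>

definition realizations :: "int list \<Rightarrow> nat set set set" where
  "realizations D =
    {E. E \<subseteq> {e. e \<subseteq> {..<length D} \<and> card e = 2} \<and>
        (\<forall>i<length D. int (card {e \<in> E. i \<in> e}) = D ! i)}"

definition graphic :: "int list \<Rightarrow> bool" where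
  "graphic D \<longleftrightarrow> realizations D \<noteq> {}"

definition pp :: "int list \<Rightarrow> real" where
  "pp D = (\<Sum>(i, j) \<in> {(i, j). i < j \<and> j < length D}.
      real (card (realizations (D[i := D ! i - 1, j := D ! j - 1])))
      / real (card (realizations D)))"

definition degree_box :: "nat \<Rightarrow> int \<Rightarrow> int \<Rightarrow> int list set" where
  "degree_box n c1 c2 =
    {D. length D = n \<and> sorted_wrt (\<ge>) D \<and> (\<forall>d \<in> set D. c2 \<le> d \<and> d \<le> c1) \<and> even (sum_list D)}"

text \<open>As in the notation \<open>\<D>(f, g)\<close>, the lower bound is the first argument of the region,
  whereas the box \<open>degree_box n c1 c2\<close> takes the upper bound first.\<close>

definition degree_region :: "(nat \<Rightarrow> int) \<Rightarrow> (nat \<Rightarrow> int) \<Rightarrow> int list set" where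
  "degree_region f g = (\<Union>n. degree_box n (g n) (f n))"

definition fully_graphic :: "int list set \<Rightarrow> bool" where
  "fully_graphic R \<longleftrightarrow> (\<forall>D \<in> R. graphic D)"

definition almost_fully_graphic :: "int list set \<Rightarrow> bool" where
  "almost_fully_graphic R \<longleftrightarrow> (\<exists>F. finite F \<and> fully_graphic (R - F))"

definition P_stable :: "int list set \<Rightarrow> bool" where
  "P_stable R \<longleftrightarrow>
    (\<exists>p :: real poly. \<forall>D \<in> R. graphic D \<longrightarrow> pp D \<le> poly p (real (length D)))"

end

theory Submission
  imports Defs
begin

text \<open>If the inner box of length \<open>n\<close> contains a sequence that is not graphic, then a violated
  Erdos-Gallai inequality at \<open>k\<close>, together with the margin \<open>h n\<close>, leaves room in the outer box
  for the degree sequence of a graph of the following shape: a clique of size \<open>k\<close>, an independent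
  set joined only to the clique, and a half graph on almost \<open>h n\<close> vertices that is completely joined
  to the clique and not at all to the independent set. The half graph is forced in every
  realization, and lowering by one the degrees of two suitable vertices of it multiplies the number
  of realizations by a factor exponential in \<open>h n\<close>. As \<open>h n\<close> grows faster than \<open>ln n\<close>, this is
  incompatible with P-stability for large \<open>n\<close>.\<close>

section \<open>Degrees and edge switches\<close>

definition pairs :: "nat \<Rightarrow> nat set set" where
  "pairs n = {e. e \<subseteq> {..<n} \<and> card e = 2}"

definition deg :: "nat set set \<Rightarrow> nat \<Rightarrow> int" where
  "deg E i = int (card {e \<in> E. i \<in> e})"

lemma realizations_altdef:
  "realizations D = {E. E \<subseteq> pairs (length D) \<and> (\<forall>i<length D. deg E i = D ! i)}"
  by (simp add: realizations_def pairs_def deg_def)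

lemma finite_pairs [simp]: "finite (pairs n)"
  unfolding pairs_def by (rule finite_subset[of _ "Pow {..<n}"]) auto

lemma finite_edges: "E \<subseteq> pairs n \<Longrightarrow> finite E"
  by (rule finite_subset[OF _ finite_pairs])

lemma finite_realizations: "finite (realizations D)"
  unfolding realizations_altdef
  by (rule finite_subset[of _ "Pow (pairs (length D))"]) auto

lemma doubleton_in_pairs: "{a, b} \<in> pairs n \<longleftrightarrow> a < n \<and> b < n \<and> a \<noteq> b"
  by (auto simp: pairs_def card_insert_if)

lemma pairsE:
  assumes "e \<in> pairs n"
  obtains a b where "e = {a, b}" "a < b" "b < n"
proof -
  obtain a b where "e = {a, b}" "a \<noteq> b"
    using assms by (auto simp: pairs_def card_2_iff)
  thus ?thesis
    using that[of a b] that[of b a] assms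
    by (cases "a < b") (auto simp: insert_commute doubleton_in_pairs)
qed

lemma deg_nonneg: "0 \<le> deg E i"
  by (simp add: deg_def)

lemma deg_mono: "finite F \<Longrightarrow> E \<subseteq> F \<Longrightarrow> deg E i \<le> deg F i"
  unfolding deg_def by (auto intro!: card_mono)

lemma deg_insert:
  assumes "finite E" "{a, b} \<notin> E"
  shows "deg (insert {a, b} E) x = deg E x + of_bool (x = a \<or> x = b)"
proof -
  have "{e \<in> insert {a, b} E. x \<in> e} =
      (if x = a \<or> x = b then insert {a, b} {e \<in> E. x \<in> e} else {e \<in> E. x \<in> e})"
    by auto
  thus ?thesis using assms by (simp add: deg_def)
qed

lemma deg_remove:
  assumes "finite E" "{a, b} \<in> E"
  shows "deg (E - {{a, b}}) x = deg E x - of_bool (x = a \<or> x = b)"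
  using deg_insert[of "E - {{a, b}}" a b x] assms by (simp add: insert_absorb)

lemma deg_eq_sum:
  assumes "E \<subseteq> pairs n"
  shows "deg E i = (\<Sum>j<n. of_bool ({i, j} \<in> E))"
proof -
  have "bij_betw (\<lambda>j. {i, j}) {j \<in> {..<n}. {i, j} \<in> E} {e \<in> E. i \<in> e}"
  proof (rule bij_betwI')
    fix e assume "e \<in> {e \<in> E. i \<in> e}"
    then obtain a b where "e = {a, b}" "a < b" "b < n" "e \<in> E" "i \<in> e"
      using assms by (auto elim!: pairsE)
    thus "\<exists>j\<in>{j \<in> {..<n}. {i, j} \<in> E}. e = {i, j}"
      by (cases "i = a") (auto simp: insert_commute intro: exI[of _ a])
  qed (auto simp: doubleton_eq_iff)
  from bij_betw_same_card[OF this] show ?thesis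
    by (simp add: deg_def sum_of_bool_eq Int_def)
qed

text \<open>Incidences counted in two orders. Weight 1 yields the parity of the degree sum; signed
  weights will force edges of a realization.\<close>

lemma weighted_handshake:
  fixes w :: "nat \<Rightarrow> int"
  assumes "E \<subseteq> pairs n"
  shows "(\<Sum>i<n. w i * deg E i) = (\<Sum>e\<in>E. \<Sum>i\<in>e. w i)"
proof -
  have fin: "finite E" using assms by (rule finite_edges)
  have "(\<Sum>i<n. w i * deg E i) = (\<Sum>i<n. \<Sum>e\<in>E. w i * of_bool (i \<in> e))"
    using fin by (simp add: deg_def sum_of_bool_eq Int_def flip: sum_distrib_left)
  also have "\<dots> = (\<Sum>e\<in>E. \<Sum>i<n. w i * of_bool (i \<in> e))"
    by (rule sum.swap)
  also have "\<dots> = (\<Sum>e\<in>E. \<Sum>i\<in>e. w i)"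
  proof (rule sum.cong)
    fix e assume "e \<in> E"
    hence "e \<subseteq> {..<n}" using assms by (auto simp: pairs_def)
    thus "(\<Sum>i<n. w i * of_bool (i \<in> e)) = (\<Sum>i\<in>e. w i)"
      by (intro sum.mono_neutral_cong_right) auto
  qed simp
  finally show ?thesis .
qed

lemma even_sum_deg:
  assumes "E \<subseteq> pairs n"
  shows "even (\<Sum>i<n. deg E i)"
proof -
  have "(\<Sum>i<n. deg E i) = (\<Sum>e\<in>E. \<Sum>i\<in>e. 1)"
    using weighted_handshake[OF assms, of "\<lambda>_. 1"] by simp
  also have "\<dots> = (\<Sum>e\<in>E. 2)"
    using assms by (intro sum.cong) (auto simp: pairs_def)
  finally show ?thesis by simp
qed

text \<open>Otherwise every neighbour of \<open>a\<close> other than \<open>v\<close> is one of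
  \<open>v\<close>, and a possible edge between \<open>a\<close> and \<open>v\<close> counts once
  for each. The edge from \<open>a\<close> to \<open>u\<close> can then be moved to
  \<open>v\<close>.\<close>

lemma ex_private_neighbour:
  assumes E: "E \<subseteq> pairs n" and "a < n" and less: "deg E v < deg E a"
  obtains u where "u < n" "u \<noteq> v" "u \<noteq> a" "{a, u} \<in> E" "{v, u} \<notin> E"
proof -
  have "\<exists>u<n. u \<noteq> v \<and> u \<noteq> a \<and> {a, u} \<in> E \<and> {v, u} \<notin> E"
  proof (rule ccontr)
    assume neg: "\<not> ?thesis"
    have "a \<noteq> v" using less by auto
    let ?A = "{j \<in> {..<n}. {a, j} \<in> E}" and ?V = "{j \<in> {..<n}. {v, j} \<in> E}"
    have nl: "{a, a} \<notin> E" "{v, v} \<notin> E"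
      using E doubleton_in_pairs by blast+
    have cards: "deg E a = int (card ?A)" "deg E v = int (card ?V)"
      using deg_eq_sum[OF E] by (simp_all add: sum_of_bool_eq Int_def)
    have "?A - {v} \<subseteq> ?V - {a}"
      using neg nl by auto
    hence "card (?A - {v}) \<le> card (?V - {a})"
      by (intro card_mono) auto
    moreover have "v \<in> ?A \<longleftrightarrow> a \<in> ?V"
      using E \<open>a < n\<close> by (auto simp: insert_commute doubleton_in_pairs)
    ultimately have "card ?A \<le> card ?V"
      using card.remove[of ?A v] card.remove[of ?V a]
      by (cases "v \<in> ?A") (simp_all del: mem_Collect_eq)
    thus False using less cards by simp
  qed
  thus ?thesis using that by blast
qed

section \<open>The Erdos-Gallai theorem\<close>

text \<open>The argument is that of Tripathi, Venugopalan and West: among the graphs with degrees at most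
  \<open>D\<close>, saturate as long a prefix as possible, then give the next vertex \<open>r\<close> as many edges as
  possible. Edges among the vertices after \<open>r\<close> play no role and are discarded. Every edge switch
  that would increase the degree of \<open>r\<close> is excluded, and this forces equality in the
  Erdos-Gallai condition for the degrees of the graph.\<close>

lemma erdos_gallai:
  assumes sorted: "sorted_wrt (\<ge>) D" and nonneg: "\<forall>d\<in>set D. 0 \<le> d"
    and even: "even (sum_list D)" and ng: "\<not> graphic D"
  shows "\<exists>k. 1 \<le> k \<and> k \<le> length D \<and>
    int k * (int k - 1) + (\<Sum>s = k..<length D. min (int k) (D ! s)) < (\<Sum>i<k. D ! i)"
proof -
  define n where "n = length D"
  define d where "d = (\<lambda>i. D ! i)"
  define sub where "sub = (\<lambda>E. E \<subseteq> pairs n \<and> (\<forall>i<n. deg E i \<le> d i))"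
  define sat where "sat = (\<lambda>r E. sub E \<and> (\<forall>i<r. deg E i = d i))"
  have dmono: "d j \<le> d i" if "i \<le> j" "j < n" for i j
    using sorted that unfolding d_def n_def sorted_wrt_iff_nth_less by (cases "i = j") auto
  have d0: "0 \<le> d i" if "i < n" for i
    using that nonneg by (simp add: d_def n_def)
  have not_all: "\<not> sat n E" for E
    using ng by (auto simp: sat_def sub_def graphic_def realizations_altdef d_def n_def)
  have "sat 0 {}"
    using d0 by (auto simp: sat_def sub_def deg_def)
  hence ex0: "\<exists>E. sat 0 E" by blast
  \<comment> \<open>The longest prefix that can be saturated has length \<open>r\<close>; it is
    shorter than \<open>n\<close> because \<open>D\<close> is not graphic.\<close>
  define r where "r = (GREATEST r. r \<le> n \<and> (\<exists>E. sat r E))"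
  have r: "r \<le> n \<and> (\<exists>E. sat r E)"
    unfolding r_def by (rule GreatestI_nat[where k = 0 and b = n]) (use ex0 in auto)
  have "r \<noteq> n" using r not_all by auto
  with r have rn: "r < n" by auto
  have no_sat: "\<not> sat (Suc r) E" for E
    using Greatest_le_nat[of "\<lambda>r. r \<le> n \<and> (\<exists>E. sat r E)" "Suc r" n] rn
    unfolding r_def[symmetric] by auto
  obtain E0 where E0: "sat r E0" using r by auto
  have bounded: "nat (deg E r) < Suc (nat (d r))" if "sat r E" for E
    using that rn by (force simp: sat_def sub_def)
  obtain E where E: "sat r E" and Emax: "\<And>E'. sat r E' \<Longrightarrow> nat (deg E' r) \<le> nat (deg E r)"
    using ex_has_greatest_nat[of "sat r" E0 "\<lambda>E. nat (deg E r)" "Suc (nat (d r))"] E0 bounded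
    by (metis less_imp_le)
  \<comment> \<open>Degrees up to index \<open>r\<close> do not change, so \<open>F\<close> is still
    extremal, and the vertices after \<open>r\<close> become independent.\<close>
  define F where "F = {e \<in> E. \<not> e \<subseteq> {r<..<n}}"
  have Epairs: "E \<subseteq> pairs n" using E by (auto simp: sat_def sub_def)
  hence finE: "finite E" by (rule finite_edges)
  have Fpairs: "F \<subseteq> pairs n" and finF: "finite F"
    using Epairs finE by (auto simp: F_def)
  have degF: "deg F i = deg E i" if "i \<le> r" for i
  proof -
    have "{e \<in> F. i \<in> e} = {e \<in> E. i \<in> e}" using that by (auto simp: F_def)
    thus ?thesis by (simp add: deg_def)
  qed
  have indep: "{s, t} \<notin> F" if "r < s" "r < t" for s t
  proof
    assume "{s, t} \<in> F"
    moreover from this have "{s, t} \<in> pairs n" using Fpairs by auto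
    ultimately show False using that by (auto simp: F_def doubleton_in_pairs)
  qed
  have Fsat: "deg F i = d i" if "i < r" for i
    using that E degF by (auto simp: sat_def)
  have Fsub: "deg F i \<le> d i" if "i < n" for i
  proof -
    have "deg F i \<le> deg E i" by (rule deg_mono[OF finE]) (auto simp: F_def)
    thus ?thesis using E that by (force simp: sat_def sub_def)
  qed
  have rdef: "deg F r < d r"
  proof (rule ccontr)
    assume "\<not> ?thesis"
    hence "deg F r = d r" using Fsub rn by force
    hence "sat (Suc r) F"
      using Fsat Fsub Fpairs by (auto simp: sat_def sub_def less_Suc_eq)
    thus False using no_sat by blast
  qed
  \<comment> \<open>This is the contradiction reached by every switch: the prefix stays saturated,
    no bound is exceeded, and \<open>r\<close> gains.\<close>
  have no_gain: False
    if "E' \<subseteq> pairs n" "\<And>i. i < n \<Longrightarrow> deg E' i \<le> d i" "\<And>i. i < r \<Longrightarrow> deg E' i = d i"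
      "deg F r < deg E' r" for E'
  proof -
    have "sat r E'" using that by (auto simp: sat_def sub_def)
    from Emax[OF this] show False using that(4) degF[of r] deg_nonneg[of E' r] deg_nonneg[of E r] by simp
  qed
  have no_loop: "{a, a} \<notin> F" for a
    using Fpairs doubleton_in_pairs by blast
  have inF: "a < n \<and> b < n \<and> a \<noteq> b" if "{a, b} \<in> F" for a b
    using that Fpairs doubleton_in_pairs by blast
  have deg_prefix: "deg F r < deg F i" if "i < r" for i
    using Fsat[OF that] rdef dmono[of i r] that rn by simp
  have case0: "{r, t} \<in> F" if "r < t" "t < n" "deg F t < d t" for t
  proof (rule ccontr)
    assume nin: "{r, t} \<notin> F"
    let ?G = "insert {r, t} F"
    have dg: "deg ?G x = deg F x + of_bool (x = r \<or> x = t)" for x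
      using deg_insert[OF finF nin] .
    show False
    proof (rule no_gain[of ?G])
      show "?G \<subseteq> pairs n" using Fpairs that rn by (auto simp: doubleton_in_pairs)
      show "deg ?G i \<le> d i" if "i < n" for i
        using Fsub[OF that] rdef \<open>deg F t < d t\<close> by (auto simp: dg of_bool_def)
      show "deg ?G i = d i" if "i < r" for i
        using Fsat[OF that] that \<open>r < t\<close> by (auto simp: dg)
      show "deg F r < deg ?G r" by (simp add: dg)
    qed
  qed
  have case1: "{r, i} \<in> F" if ir: "i < r" for i
  proof (rule ccontr)
    assume nin: "{r, i} \<notin> F"
    obtain u where u: "u < n" "u \<noteq> r" "u \<noteq> i" "{i, u} \<in> F" "{r, u} \<notin> F"
      using ex_private_neighbour[OF Fpairs _ deg_prefix[OF ir]] ir rn by auto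
    \<comment> \<open>Edge \<open>iu\<close> is replaced by \<open>ru\<close> and \<open>ri\<close>:
      \<open>i\<close> and \<open>u\<close> keep their degrees and \<open>r\<close> gains
      two.\<close>
    let ?G0 = "F - {{i, u}}"
    let ?G1 = "insert {r, u} ?G0"
    let ?G2 = "insert {r, i} ?G1"
    have dg: "deg ?G2 x = deg F x - of_bool (x = i \<or> x = u)
        + of_bool (x = r \<or> x = u) + of_bool (x = r \<or> x = i)" for x
    proof -
      have "deg ?G2 x = deg ?G1 x + of_bool (x = r \<or> x = i)"
        by (rule deg_insert) (use finF nin u in \<open>auto simp: doubleton_eq_iff\<close>)
      also have "deg ?G1 x = deg ?G0 x + of_bool (x = r \<or> x = u)"
        by (rule deg_insert) (use finF u in auto)
      also have "deg ?G0 x = deg F x - of_bool (x = i \<or> x = u)"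
        by (rule deg_remove) (use finF u in auto)
      finally show ?thesis .
    qed
    have G2: "?G2 \<subseteq> pairs n" using Fpairs u rn ir by (auto simp: doubleton_in_pairs)
    show False
    proof (cases "deg F r + 2 \<le> d r")
      case True
      show False
      proof (rule no_gain[of ?G2])
        show "deg ?G2 j \<le> d j" if "j < n" for j
          using Fsub[OF that] True ir u by (auto simp: dg of_bool_def)
        show "deg ?G2 j = d j" if "j < r" for j
          using Fsat[OF that] that u by (auto simp: dg of_bool_def)
        show "deg F r < deg ?G2 r" using u ir by (simp add: dg)
      qed (rule G2)
    next
      case False
      hence one: "d r = deg F r + 1" using rdef by simp
      \<comment> \<open>Here \<open>r\<close> lacks only one, so an edge \<open>rt\<close> must be
        given up as well. A deficient \<open>t\<close> exists by parity: were \<open>r\<close> the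
        only deficient vertex, the degrees of \<open>F\<close> would add up to one less than the
        even sum of \<open>D\<close>.\<close>
      have "\<exists>t. r < t \<and> t < n \<and> deg F t < d t"
      proof (rule ccontr)
        assume "\<not> ?thesis"
        hence "deg F t = d t" if "t < n" "t \<noteq> r" for t
          using Fsat Fsub that by (metis linorder_neqE_nat order_le_less)
        hence "(\<Sum>t<n. d t) = (\<Sum>t<n. deg F t + of_bool (t = r))"
          using one by (intro sum.cong) auto
        also have "\<dots> = (\<Sum>t<n. deg F t) + 1"
          using rn by (simp add: sum.distrib sum_of_bool_eq)
        finally have "odd (\<Sum>t<n. d t)" using even_sum_deg[OF Fpairs] by simp
        thus False using even by (simp add: sum_list_sum_nth d_def n_def atLeast0LessThan)
      qed
      then obtain t where t: "r < t" "t < n" "deg F t < d t" by blast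
      have rt: "{r, t} \<in> F" by (rule case0[OF t])
      hence "u \<noteq> t" using u by auto
      let ?G3 = "?G2 - {{r, t}}"
      have dg3: "deg ?G3 x = deg ?G2 x - of_bool (x = r \<or> x = t)" for x
        by (rule deg_remove) (use finF rt ir t u in \<open>auto simp: doubleton_eq_iff\<close>)
      show False
      proof (rule no_gain[of ?G3])
        show "deg ?G3 j \<le> d j" if "j < n" for j
          using Fsub[OF that] one ir u t \<open>u \<noteq> t\<close> by (auto simp: dg dg3 of_bool_def)
        show "deg ?G3 j = d j" if "j < r" for j
          using Fsat[OF that] that u t by (auto simp: dg dg3 of_bool_def)
        show "deg F r < deg ?G3 r" using u ir t by (simp add: dg dg3)
        show "?G3 \<subseteq> pairs n" using G2 by blast
      qed
    qed
  qed
  have case2: "deg F t = min (int (Suc r)) (d t)" if t: "r < t" "t < n" for t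
  proof (rule ccontr)
    assume ne: "\<not> ?thesis"
    have dt: "deg F t = (\<Sum>j<n. of_bool ({t, j} \<in> F))" by (rule deg_eq_sum[OF Fpairs])
    \<comment> \<open>By independence, all neighbours of \<open>t\<close> are among the first
      \<open>r + 1\<close> vertices.\<close>
    have "deg F t = (\<Sum>j<Suc r. of_bool ({t, j} \<in> F))"
      unfolding dt using rn t indep by (intro sum.mono_neutral_right) auto
    moreover have "\<dots> \<le> (\<Sum>j<Suc r. 1)" by (rule sum_mono) auto
    ultimately have "deg F t < int (Suc r)" "deg F t < d t"
      using ne Fsub[OF t(2)] by auto
    have "{r, t} \<in> F" using case0 t \<open>deg F t < d t\<close> by blast
    have "\<exists>i<r. {t, i} \<notin> F"
    proof (rule ccontr)
      assume "\<not> ?thesis"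
      hence "{t, j} \<in> F" if "j < Suc r" for j
        using that \<open>{r, t} \<in> F\<close> by (auto simp: less_Suc_eq insert_commute)
      hence "(\<Sum>j<Suc r. of_bool ({t, j} \<in> F)) = (\<Sum>j<Suc r. 1::int)" by (intro sum.cong) auto
      thus False using \<open>deg F t < int (Suc r)\<close> \<open>deg F t = (\<Sum>j<Suc r. _ j)\<close> by simp
    qed
    then obtain i where i: "i < r" "{t, i} \<notin> F" by blast
    obtain u where u: "u < n" "u \<noteq> r" "u \<noteq> i" "{i, u} \<in> F" "{r, u} \<notin> F"
      using ex_private_neighbour[OF Fpairs _ deg_prefix[OF i(1)]] i rn by auto
    have "u \<noteq> t" using u \<open>{r, t} \<in> F\<close> by auto
    \<comment> \<open>Replacing \<open>iu\<close> by \<open>ru\<close> and \<open>ti\<close> raises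
      only \<open>r\<close> and \<open>t\<close>, both deficient, by one.\<close>
    let ?G0 = "F - {{i, u}}"
    let ?G1 = "insert {r, u} ?G0"
    let ?G2 = "insert {t, i} ?G1"
    have dg: "deg ?G2 x = deg F x - of_bool (x = i \<or> x = u)
        + of_bool (x = r \<or> x = u) + of_bool (x = t \<or> x = i)" for x
    proof -
      have "deg ?G2 x = deg ?G1 x + of_bool (x = t \<or> x = i)"
        by (rule deg_insert) (use finF i t u in \<open>auto simp: doubleton_eq_iff\<close>)
      also have "deg ?G1 x = deg ?G0 x + of_bool (x = r \<or> x = u)"
        by (rule deg_insert) (use finF u in auto)
      also have "deg ?G0 x = deg F x - of_bool (x = i \<or> x = u)"
        by (rule deg_remove) (use finF u in auto)
      finally show ?thesis .
    qed
    show False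
    proof (rule no_gain[of ?G2])
      show "?G2 \<subseteq> pairs n" using Fpairs u rn i t by (auto simp: doubleton_in_pairs)
      show "deg ?G2 j \<le> d j" if "j < n" for j
        using Fsub[OF that] rdef i u t \<open>deg F t < d t\<close> \<open>u \<noteq> t\<close> by (auto simp: dg of_bool_def)
      show "deg ?G2 j = d j" if "j < r" for j
        using Fsat[OF that] that u t by (auto simp: dg of_bool_def)
      show "deg F r < deg ?G2 r" using u i t by (simp add: dg)
    qed
  qed
  have case3: "{i, j} \<in> F" if ij: "i < r" "j < r" "i \<noteq> j" for i j
  proof (rule ccontr)
    assume nin: "{i, j} \<notin> F"
    obtain u where u: "u < n" "u \<noteq> r" "u \<noteq> i" "{i, u} \<in> F" "{r, u} \<notin> F"
      using ex_private_neighbour[OF Fpairs _ deg_prefix[OF ij(1)]] ij rn by auto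
    obtain t where t: "t < n" "t \<noteq> r" "t \<noteq> j" "{j, t} \<in> F" "{r, t} \<notin> F"
      using ex_private_neighbour[OF Fpairs _ deg_prefix[OF ij(2)]] ij rn by auto
    \<comment> \<open>Since \<open>r\<close> is adjacent to all earlier vertices, its non-neighbours
      \<open>u\<close> and \<open>t\<close> come after it. The switch below therefore may lower the
      degree of \<open>t\<close>, also when \<open>u = t\<close>; it preserves those of
      \<open>i\<close> and \<open>j\<close> and raises that of \<open>r\<close>.\<close>
    have ut: "r < u" "r < t" using case1 u t by (meson linorder_neqE_nat)+
    let ?G0 = "F - {{i, u}}"
    let ?G1 = "insert {r, u} ?G0"
    let ?G2 = "insert {i, j} ?G1"
    let ?G3 = "?G2 - {{j, t}}"
    have dg: "deg ?G3 x = deg F x - of_bool (x = i \<or> x = u) + of_bool (x = r \<or> x = u)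
        + of_bool (x = i \<or> x = j) - of_bool (x = j \<or> x = t)" for x
    proof -
      have "deg ?G3 x = deg ?G2 x - of_bool (x = j \<or> x = t)"
        by (rule deg_remove) (use finF ij t u ut in \<open>auto simp: doubleton_eq_iff\<close>)
      also have "deg ?G2 x = deg ?G1 x + of_bool (x = i \<or> x = j)"
        by (rule deg_insert) (use finF nin ij t u in \<open>auto simp: doubleton_eq_iff\<close>)
      also have "deg ?G1 x = deg ?G0 x + of_bool (x = r \<or> x = u)"
        by (rule deg_insert) (use finF u in auto)
      also have "deg ?G0 x = deg F x - of_bool (x = i \<or> x = u)"
        by (rule deg_remove) (use finF u in auto)
      finally show ?thesis .
    qed
    show False
    proof (rule no_gain[of ?G3])
      show "?G3 \<subseteq> pairs n" using Fpairs u rn ij by (auto simp: doubleton_in_pairs)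
      show "deg ?G3 x \<le> d x" if "x < n" for x
        using Fsub[OF that] rdef ij u t ut by (auto simp: dg of_bool_def)
      show "deg ?G3 x = d x" if "x < r" for x
        using Fsat[OF that] that ij ut by (auto simp: dg of_bool_def)
      show "deg F r < deg ?G3 r" using ut ij by (simp add: dg)
    qed
  qed
  define k where "k = Suc r"
  have kn: "k \<le> n" using rn by (simp add: k_def)
  have clique: "{i, j} \<in> F" if "i < k" "j < k" "i \<noteq> j" for i j
    using that case1 case3 by (auto simp: k_def less_Suc_eq insert_commute)
  have split: "{..<n} = {..<k} \<union> {k..<n}" using kn by auto
  \<comment> \<open>The first \<open>k\<close> vertices form a clique, and the edges leaving it are
    then counted from the other end, where each later vertex has degree
    \<open>min k (d s)\<close>.\<close>
  have "(\<Sum>i<k. deg F i) = (\<Sum>i<k. (int k - 1) + (\<Sum>s=k..<n. of_bool ({i, s} \<in> F)))"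
  proof (rule sum.cong)
    fix i assume "i \<in> {..<k}"
    hence "(\<Sum>j<k. of_bool ({i, j} \<in> F)) = (\<Sum>j<k. of_bool (j \<noteq> i) :: int)"
      using clique no_loop by (intro sum.cong) auto
    also have "\<dots> = int k - 1"
    proof -
      have "{..<k} \<inter> {j. j \<noteq> i} = {..<k} - {i}" by auto
      hence "card ({..<k} \<inter> {j. j \<noteq> i}) = k - 1" using \<open>i \<in> {..<k}\<close> by simp
      moreover have "k > 0" by (simp add: k_def)
      ultimately show ?thesis by (simp add: sum_of_bool_eq of_nat_diff)
    qed
    finally show "deg F i = (int k - 1) + (\<Sum>s=k..<n. of_bool ({i, s} \<in> F))"
      unfolding deg_eq_sum[OF Fpairs] split by (subst sum.union_disjoint) auto
  qed simp
  also have "\<dots> = int k * (int k - 1) + (\<Sum>i<k. \<Sum>s=k..<n. of_bool ({i, s} \<in> F))"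
    by (simp add: sum.distrib)
  also have "(\<Sum>i<k. \<Sum>s=k..<n. of_bool ({i, s} \<in> F)) = (\<Sum>s=k..<n. \<Sum>i<k. of_bool ({i, s} \<in> F) :: int)"
    by (rule sum.swap)
  also have "\<dots> = (\<Sum>s=k..<n. deg F s)"
  proof (rule sum.cong)
    fix s assume s: "s \<in> {k..<n}"
    have "(\<Sum>i<k. of_bool ({i, s} \<in> F) :: int) = (\<Sum>i<n. of_bool ({i, s} \<in> F))"
      using kn s indep by (intro sum.mono_neutral_left) (auto simp: k_def)
    thus "(\<Sum>i<k. of_bool ({i, s} \<in> F) :: int) = deg F s"
      unfolding deg_eq_sum[OF Fpairs] by (simp add: insert_commute)
  qed simp
  also have "\<dots> = (\<Sum>s=k..<n. min (int k) (d s))"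
    using case2 by (intro sum.cong) (auto simp: k_def)
  finally have "(\<Sum>i<k. deg F i) = int k * (int k - 1) + (\<Sum>s=k..<n. min (int k) (d s))" .
  moreover have "(\<Sum>i<k. deg F i) < (\<Sum>i<k. d i)"
    using rdef Fsat by (simp add: k_def)
  ultimately show ?thesis
    using kn by (intro exI[of _ k]) (auto simp: k_def d_def n_def)
qed

section \<open>Half graphs\<close>

text \<open>Double counting of the total weight: \<open>G\<close> has the largest weight among all graphs, and any
  graph of the same weight agrees with it on the pairs of nonzero weight.\<close>

lemma forced_pairs:
  fixes w :: "nat \<Rightarrow> int"
  assumes G: "G \<subseteq> pairs n" and E: "E \<subseteq> pairs n"
    and eq: "\<And>i. i < n \<Longrightarrow> deg E i = deg G i"
    and pos: "\<And>i j. i < j \<Longrightarrow> j < n \<Longrightarrow> 0 < w i + w j \<Longrightarrow> {i, j} \<in> G"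
    and neg: "\<And>i j. i < j \<Longrightarrow> j < n \<Longrightarrow> w i + w j < 0 \<Longrightarrow> {i, j} \<notin> G"
    and ij: "i < j" "j < n" "w i + w j \<noteq> 0"
  shows "{i, j} \<in> E \<longleftrightarrow> {i, j} \<in> G"
proof -
  define W where "W = (\<lambda>e. \<Sum>i\<in>e. w i)"
  have ind: "(\<Sum>e\<in>H. W e) = (\<Sum>e\<in>pairs n. W e * of_bool (e \<in> H))" if "H \<subseteq> pairs n" for H
    using that by (intro sum.mono_neutral_cong_left) auto
  have "(\<Sum>e\<in>G. W e) = (\<Sum>e\<in>E. W e)"
    unfolding W_def weighted_handshake[OF G, symmetric] weighted_handshake[OF E, symmetric]
    using eq by (intro sum.cong) auto
  hence zero: "(\<Sum>e\<in>pairs n. W e * (of_bool (e \<in> G) - of_bool (e \<in> E))) = 0"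
    by (simp add: ind[OF G] ind[OF E] algebra_simps sum_subtractf)
  \<comment> \<open>\<open>G\<close> contains all pairs of positive weight and none of negative
    weight, so no term is negative; as the sum vanishes, every term does.\<close>
  have "0 \<le> W e * (of_bool (e \<in> G) - of_bool (e \<in> E))" if "e \<in> pairs n" for e
  proof -
    obtain a b where ab: "e = {a, b}" "a < b" "b < n" using pairsE[OF \<open>e \<in> pairs n\<close>] .
    hence "W e = w a + w b" by (simp add: W_def)
    thus ?thesis using pos[OF ab(2,3)] neg[OF ab(2,3)] ab(1)
      by (cases "W e" "0::int" rule: linorder_cases) auto
  qed
  hence "W e * (of_bool (e \<in> G) - of_bool (e \<in> E)) = 0" if "e \<in> pairs n" for e
    using zero that by (subst (asm) sum_nonneg_eq_0_iff) auto
  from this[of "{i, j}"] show ?thesis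
    using ij by (auto simp: W_def doubleton_in_pairs of_bool_def split: if_splits)
qed

text \<open>In a half graph the deficiency of \<open>a (2 * t)\<close> can be passed on to \<open>a (2 * t + 2)\<close> through
  either of \<open>b (2 * t)\<close> and \<open>b (2 * t + 1)\<close>, so that each step doubles the number of
  realizations.\<close>

lemma half_graph_doubling:
  fixes a b :: "nat \<Rightarrow> nat"
  assumes a: "\<And>p. p < 2 * r + 1 \<Longrightarrow> a p < length D"
    and b: "\<And>q. q < 2 * r + 1 \<Longrightarrow> b q < length D"
    and inj_a: "inj_on a {..<2 * r + 1}" and inj_b: "inj_on b {..<2 * r + 1}"
    and disj: "\<And>p q. p < 2 * r + 1 \<Longrightarrow> q < 2 * r + 1 \<Longrightarrow> a p \<noteq> b q"
    and half: "\<And>E p q. E \<in> realizations D \<Longrightarrow> p < 2 * r + 1 \<Longrightarrow> q < 2 * r + 1 \<Longrightarrow>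
      {a p, b q} \<in> E \<longleftrightarrow> p \<le> q"
  shows "2 ^ r * card (realizations D) \<le>
    card (realizations (D[a 0 := D ! a 0 - 1, b (2 * r) := D ! b (2 * r) - 1]))"
proof -
  define n where "n = length D"
  \<comment> \<open>The deficiency has moved from \<open>a 0\<close> to \<open>a (2 * t)\<close>.
    Only columns \<open>q < 2 * t\<close> have been touched, so the half graph pattern survives in
    the others; at \<open>t = 0\<close> the degrees are those of \<open>D\<close>.\<close>
  define A where "A = (\<lambda>t. {E. E \<subseteq> pairs n \<and>
      (\<forall>i<n. deg E i = D ! i - of_bool (i = a 0) + of_bool (i = a (2 * t))) \<and>
      (\<forall>p<2 * r + 1. \<forall>q<2 * r + 1. 2 * t \<le> q \<longrightarrow> ({a p, b q} \<in> E \<longleftrightarrow> p \<le> q))})"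
  have finA: "finite (A t)" for t
    unfolding A_def by (rule finite_subset[of _ "Pow (pairs n)"]) auto
  have finE: "finite E" if "E \<in> A t" for E t
    using that finite_subset[OF _ finite_pairs] by (auto simp: A_def)
  have a_eq: "a p = a p' \<longleftrightarrow> p = p'" if "p < 2 * r + 1" "p' < 2 * r + 1" for p p'
    using inj_a that by (auto simp: inj_on_eq_iff)
  have b_eq: "b p = b p' \<longleftrightarrow> p = p'" if "p < 2 * r + 1" "p' < 2 * r + 1" for p p'
    using inj_b that by (auto simp: inj_on_eq_iff)
  have pair_eq: "{a p, b q} = {a p', b q'} \<longleftrightarrow> p = p' \<and> q = q'"
    if "p < 2 * r + 1" "p' < 2 * r + 1" "q < 2 * r + 1" "q' < 2 * r + 1" for p p' q q'
    using that disj[of p q'] disj[of p' q] a_eq[of p p'] b_eq[of q q']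
    by (auto simp: doubleton_eq_iff)
  have step: "2 * card (A t) \<le> card (A (Suc t))" if t: "t < r" for t
  proof -
    \<comment> \<open>Both choices of \<open>q\<close> are possible because
      \<open>2 * t \<le> q < 2 * t + 2\<close>: column \<open>q\<close> meets row
      \<open>2 * t\<close> but not row \<open>2 * t + 2\<close>.\<close>
    define \<phi> where "\<phi> = (\<lambda>q E. insert {a (2 * t + 2), b q} (E - {{a (2 * t), b q}}))"
    have edges: "{a (2 * t), b q} \<in> E \<and> {a (2 * t + 2), b q} \<notin> E"
      if "E \<in> A t" "q = 2 * t \<or> q = 2 * t + 1" for E q
      using that t by (auto simp: A_def)
    have into: "\<phi> q E \<in> A (Suc t)" if E: "E \<in> A t" and q: "q = 2 * t \<or> q = 2 * t + 1" for E q
    proof -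
      have qr: "q < 2 * r + 1" and tr: "2 * t + 2 < 2 * r + 1" using q t by auto
      have fin: "finite E" using finE E .
      have "deg (\<phi> q E) i = deg E i - of_bool (i = a (2 * t) \<or> i = b q)
          + of_bool (i = a (2 * t + 2) \<or> i = b q)" for i
        unfolding \<phi>_def using edges[OF E q] fin
        by (subst deg_insert) (auto simp: deg_remove)
      hence "deg (\<phi> q E) i = D ! i - of_bool (i = a 0) + of_bool (i = a (2 * Suc t))" if "i < n" for i
        using E that disj[of "2 * t" q] disj[of "2 * t + 2" q] qr tr
        by (auto simp: A_def of_bool_def)
      moreover have "\<phi> q E \<subseteq> pairs n"
        using E a[OF tr] b[OF qr] disj[OF tr qr]
        by (auto simp: \<phi>_def A_def doubleton_in_pairs n_def)
      moreover have "{a p, b q'} \<in> \<phi> q E \<longleftrightarrow> p \<le> q'"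
        if "p < 2 * r + 1" "q' < 2 * r + 1" "2 * Suc t \<le> q'" for p q'
        using that E q qr tr pair_eq[of p "2 * t + 2" q' q] pair_eq[of p "2 * t" q' q]
        by (auto simp: \<phi>_def A_def)
      ultimately show ?thesis by (auto simp: A_def)
    qed
    have inj: "inj_on (\<phi> q) (A t)" if q: "q = 2 * t \<or> q = 2 * t + 1" for q
    proof (rule inj_on_inverseI[where g = "\<lambda>E. insert {a (2 * t), b q} (E - {{a (2 * t + 2), b q}})"])
      fix E assume "E \<in> A t"
      from edges[OF this q]
      show "insert {a (2 * t), b q} (\<phi> q E - {{a (2 * t + 2), b q}}) = E"
        by (auto simp: \<phi>_def)
    qed
    have "\<phi> (2 * t) ` A t \<inter> \<phi> (2 * t + 1) ` A t = {}"
    proof -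
      have "{a (2 * t + 2), b (2 * t)} \<in> \<phi> (2 * t) E" for E by (simp add: \<phi>_def)
      moreover have "{a (2 * t + 2), b (2 * t)} \<notin> \<phi> (2 * t + 1) E" if "E \<in> A t" for E
        using edges[OF that, of "2 * t"] pair_eq[of "2 * t + 2" "2 * t + 2" "2 * t" "2 * t + 1"] t
        by (auto simp: \<phi>_def)
      ultimately show ?thesis by fastforce
    qed
    hence "card (\<phi> (2 * t) ` A t \<union> \<phi> (2 * t + 1) ` A t) = 2 * card (A t)"
      using inj finA by (subst card_Un_disjoint) (auto simp: card_image)
    moreover have "\<phi> (2 * t) ` A t \<union> \<phi> (2 * t + 1) ` A t \<subseteq> A (Suc t)"
      using into by auto
    ultimately show ?thesis using card_mono[OF finA] by metis
  qed
  have iter: "t \<le> r \<Longrightarrow> 2 ^ t * card (A 0) \<le> card (A t)" for t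
  proof (induction t)
    case (Suc t)
    thus ?case using step[of t] by simp
  qed simp
  have start: "realizations D \<subseteq> A 0"
    using half by (auto simp: A_def realizations_altdef n_def)
  let ?e = "{a (2 * r), b (2 * r)}"
  let ?D = "D[a 0 := D ! a 0 - 1, b (2 * r) := D ! b (2 * r) - 1]"
  have mem: "?e \<in> E" if "E \<in> A r" for E using that by (auto simp: A_def)
  \<comment> \<open>Deleting this last edge cancels the surplus at \<open>a (2 * r)\<close> and
    leaves the deficits at \<open>a 0\<close> and \<open>b (2 * r)\<close>.\<close>
  have "(\<lambda>E. E - {?e}) ` A r \<subseteq> realizations ?D"
  proof (rule image_subsetI)
    fix E assume E: "E \<in> A r"
    have "deg (E - {?e}) i = ?D ! i" if "i < n" for i
      using E that disj[of 0 "2 * r"] disj[of "2 * r" "2 * r"]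
      by (subst deg_remove[OF finE[OF E] mem[OF E]])
        (auto simp: A_def n_def nth_list_update of_bool_def)
    thus "E - {?e} \<in> realizations ?D"
      using E by (auto simp: realizations_altdef n_def A_def)
  qed
  moreover have "inj_on (\<lambda>E. E - {?e}) (A r)"
    by (rule inj_on_inverseI[where g = "insert ?e"]) (use mem in auto)
  ultimately have "card (A r) \<le> card (realizations ?D)"
    by (metis card_inj_on_le finite_realizations)
  moreover have "2 ^ r * card (realizations D) \<le> 2 ^ r * card (A 0)"
    using card_mono[OF finA start] by simp
  ultimately show ?thesis using iter[of r] by linarith
qed

section \<open>Lower bounds for \<open>pp\<close> from half graphs\<close>

lemma pp_ge_single:
  assumes "i < j" "j < length D"
  shows "real (card (realizations (D[i := D ! i - 1, j := D ! j - 1])))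
      / real (card (realizations D)) \<le> pp D"
proof -
  have "finite {(i, j). i < j \<and> j < length D}"
    by (rule finite_subset[of _ "{..<length D} \<times> {..<length D}"]) auto
  thus ?thesis
    unfolding pp_def using assms
    by (intro order.trans[OF _ member_le_sum[where i = "(i, j)"]]) auto
qed

lemma half_graph_pp:
  fixes a b :: "nat \<Rightarrow> nat"
  assumes "graphic D"
    and "\<And>p. p < 2 * r + 1 \<Longrightarrow> a p < length D"
    and "\<And>q. q < 2 * r + 1 \<Longrightarrow> b q < length D"
    and "inj_on a {..<2 * r + 1}" and "inj_on b {..<2 * r + 1}"
    and less: "\<And>p q. p < 2 * r + 1 \<Longrightarrow> q < 2 * r + 1 \<Longrightarrow> a p < b q"
    and "\<And>E p q. E \<in> realizations D \<Longrightarrow> p < 2 * r + 1 \<Longrightarrow> q < 2 * r + 1 \<Longrightarrow>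
      {a p, b q} \<in> E \<longleftrightarrow> p \<le> q"
  shows "2 ^ r \<le> pp D"
proof -
  have "card (realizations D) > 0"
    using assms(1) finite_realizations by (auto simp: graphic_def card_gt_0_iff)
  let ?D = "D[a 0 := D ! a 0 - 1, b (2 * r) := D ! b (2 * r) - 1]"
  have "2 ^ r * card (realizations D) \<le> card (realizations ?D)"
    using assms less_imp_neq[OF less] by (intro half_graph_doubling) auto
  hence "2 ^ r * real (card (realizations D)) \<le> real (card (realizations ?D))"
    by (metis of_nat_le_iff of_nat_mult of_nat_numeral of_nat_power)
  hence "2 ^ r \<le> real (card (realizations ?D)) / real (card (realizations D))"
    using \<open>card (realizations D) > 0\<close> by (simp add: pos_le_divide_eq)
  also have "\<dots> \<le> pp D"
    using less assms(3) by (intro pp_ge_single) auto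
  finally show ?thesis .
qed

section \<open>The graph in the outer box\<close>

text \<open>Wrapping the rows cyclically around the columns balances the column sums.\<close>

lemma balanced_bipartite:
  fixes k l x :: nat
  assumes "x \<le> l"
  obtains B :: "nat \<Rightarrow> nat \<Rightarrow> bool" where
    "\<And>i. card {c. c < l \<and> B i c} = x"
    "\<And>c c'. c \<le> c' \<Longrightarrow> c' < l \<Longrightarrow> card {i. i < k \<and> B i c'} \<le> card {i. i < k \<and> B i c}"
    "\<And>c q. c < l \<Longrightarrow> q * l \<le> k * x \<Longrightarrow> q \<le> card {i. i < k \<and> B i c}"
proof -
  \<comment> \<open>Of the \<open>k * x\<close> slots, row \<open>i\<close> owns a block of
    \<open>x\<close> consecutive ones, and slot \<open>s\<close> goes to column
    \<open>s mod l\<close>. As \<open>x \<le> l\<close>, a block never hits a column twice.\<close>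
  define B where "B = (\<lambda>i c. \<exists>s. i * x \<le> s \<and> s < Suc i * x \<and> s mod l = c)"
  define S where "S = (\<lambda>c. {s. s < k * x \<and> s mod l = c})"
  have finS: "finite (S c)" for c by (simp add: S_def)
  have close: "s = s'" if "s mod l = s' mod l" "i * x \<le> s" "s < Suc i * x" "i * x \<le> s'" "s' < Suc i * x"
    for s s' i
    using that
  proof (induction s s' rule: linorder_wlog)
    case (le s s')
    hence "l dvd s' - s" by (metis mod_eq_dvd_iff_nat)
    moreover have "s' - s < l" using le assms by simp
    ultimately show ?case using le(1) by (auto dest: dvd_imp_le)
  qed metis
  have row: "card {c. c < l \<and> B i c} = x" for i
  proof -
    have "inj_on (\<lambda>s. s mod l) {i * x..<Suc i * x}"
    proof (rule inj_onI)
      fix s s' assume "s \<in> {i * x..<Suc i * x}" "s' \<in> {i * x..<Suc i * x}" "s mod l = s' mod l"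
      thus "s = s'" by (intro close[of s s' i]) simp_all
    qed
    moreover have "(\<lambda>s. s mod l) ` {i * x..<Suc i * x} = {c. c < l \<and> B i c}"
      using assms by (auto simp: B_def)
    ultimately show ?thesis by (metis card_image card_atLeastLessThan add_diff_cancel_right' mult_Suc)
  qed
  have col: "card {i. i < k \<and> B i c} = card (S c)" for c
  proof -
    have block: "s div x * x \<le> s" "s < Suc (s div x) * x" if "s < k * x" for s
      using that dividend_less_div_times[of x s] by (cases "x = 0"; simp)+
    have "inj_on (\<lambda>s. s div x) (S c)"
    proof (rule inj_onI)
      fix s s' assume "s \<in> S c" "s' \<in> S c" "s div x = s' div x"
      thus "s = s'" using close[of s s' "s div x"] block[of s] block[of s'] by (auto simp: S_def)
    qed
    moreover have "(\<lambda>s. s div x) ` S c = {i. i < k \<and> B i c}"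
    proof (intro equalityI subsetI)
      fix i assume "i \<in> (\<lambda>s. s div x) ` S c"
      then obtain s where "i = s div x" "s < k * x" "s mod l = c" by (auto simp: S_def)
      thus "i \<in> {i. i < k \<and> B i c}"
        using block[of s] by (auto simp: B_def less_mult_imp_div_less intro!: exI[of _ s])
    next
      fix i assume "i \<in> {i. i < k \<and> B i c}"
      then obtain s where s: "i < k" "i * x \<le> s" "s < Suc i * x" "s mod l = c"
        by (auto simp: B_def)
      have "s div x = i" using s by (intro div_nat_eqI) (auto simp: mult.commute)
      moreover have "Suc i * x \<le> k * x" using s(1) by (intro mult_right_mono) auto
      ultimately show "i \<in> (\<lambda>s. s div x) ` S c" using s by (auto simp: S_def)
    qed
    ultimately show ?thesis by (metis card_image)
  qed
  \<comment> \<open>Shifting slots down by \<open>c' - c\<close> embeds one residue class into the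
    other.\<close>
  have anti: "card (S c') \<le> card (S c)" if "c \<le> c'" "c' < l" for c c'
  proof (rule card_inj_on_le[OF _ _ finS])
    have ge: "c' \<le> s" if "s \<in> S c'" for s using that by (auto simp: S_def)
    show "inj_on (\<lambda>s. s - (c' - c)) (S c')"
    proof (rule inj_onI)
      fix s t assume "s \<in> S c'" "t \<in> S c'" "s - (c' - c) = t - (c' - c)"
      thus "s = t" using ge[of s] ge[of t] by simp
    qed
    show "(\<lambda>s. s - (c' - c)) ` S c' \<subseteq> S c"
    proof (rule image_subsetI)
      fix s assume s: "s \<in> S c'"
      have "s = l * (s div l) + c'" using s by (auto simp: S_def)
      hence "s - (c' - c) = l * (s div l) + c" using that by linarith
      hence "(s - (c' - c)) mod l = c" using that by simp
      thus "s - (c' - c) \<in> S c" using s by (auto simp: S_def)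
    qed
  qed
  \<comment> \<open>The slots contain \<open>q\<close> full rounds through all columns.\<close>
  have lower: "q \<le> card (S c)" if c: "c < l" and q: "q * l \<le> k * x" for c q
  proof -
    have "(\<lambda>j. c + j * l) ` {..<q} \<subseteq> S c"
    proof (rule image_subsetI)
      fix j assume "j \<in> {..<q}"
      hence "Suc j * l \<le> q * l" by (intro mult_right_mono) auto
      thus "c + j * l \<in> S c" using c q by (auto simp: S_def)
    qed
    moreover have "inj_on (\<lambda>j. c + j * l) {..<q}" using c by (auto simp: inj_on_def)
    ultimately show ?thesis by (metis card_inj_on_le card_lessThan finS)
  qed
  show ?thesis
    by (rule that[of B]) (use row anti lower in \<open>auto simp: col\<close>)
qed

text \<open>The first \<open>k\<close> vertices form a clique, the next \<open>2 * m\<close> a half graph completely joined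
  to this clique, and the others an independent set joined only to the clique. The vertex weights
  \<open>w\<close> force everything but the edges between the clique and the independent set.\<close>

lemma half_graph_in_box:
  fixes n k x lo hi r m :: nat
  defines "m \<equiv> 2 * r + 1"
  assumes kn: "k + 2 * m \<le> n" and x: "x \<le> n - (k + 2 * m)"
    and lo: "lo \<le> k" "lo * (n - (k + 2 * m)) \<le> k * x" and hi: "k + 2 * m + x \<le> hi + 1"
  shows "\<exists>D\<in>degree_box n (int hi) (int lo). graphic D \<and> 2 ^ r \<le> pp D"
proof -
  define V where "V = k + 2 * m"
  define l where "l = n - V"
  have m: "m > 0" by (simp add: m_def)
  have n: "n = V + l" using kn by (simp add: V_def l_def)
  obtain B where row: "\<And>i. card {c. c < l \<and> B i c} = x"
    and anti: "\<And>c c'. c \<le> c' \<Longrightarrow> c' < l \<Longrightarrow> card {i. i < k \<and> B i c'} \<le> card {i. i < k \<and> B i c}"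
    and lower: "\<And>c q. c < l \<Longrightarrow> q * l \<le> k * x \<Longrightarrow> q \<le> card {i. i < k \<and> B i c}"
    using balanced_bipartite[of x l k] x by (auto simp: l_def V_def)
  \<comment> \<open>In the middle part, \<open>i + j < k + V\<close> is a threshold rule: its first
    half is a clique, its second half is independent, and \<open>k + p\<close> meets
    \<open>V - 1 - q\<close> exactly when \<open>p \<le> q\<close>.\<close>
  define adj where "adj = (\<lambda>i j. if i < k \<and> V \<le> j then B i (j - V)
      else if j < k \<and> V \<le> i then B j (i - V) else i < k \<or> j < k \<or> i + j < k + V)"
  define G where "G = {{i, j} | i j. i < j \<and> j < n \<and> adj i j}"
  have adj_sym: "adj i j = adj j i" for i j by (auto simp: adj_def V_def)
  have inG: "{i, j} \<in> G \<longleftrightarrow> i < n \<and> j < n \<and> i \<noteq> j \<and> adj i j" for i j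
    using adj_sym by (auto simp: G_def doubleton_eq_iff) (metis linorder_neqE_nat)
  have G: "G \<subseteq> pairs n" by (auto simp: G_def doubleton_in_pairs)
  have degG: "deg G i = int (card {j. j < n \<and> j \<noteq> i \<and> adj i j})" if "i < n" for i
  proof -
    have "{..<n} \<inter> {j. {i, j} \<in> G} = {j. j < n \<and> j \<noteq> i \<and> adj i j}" using that inG by auto
    thus ?thesis using deg_eq_sum[OF G] by (simp add: sum_of_bool_eq)
  qed
  have deg_clique: "deg G i = int (V - 1 + x)" if i: "i < k" for i
  proof -
    have "{j. j < n \<and> j \<noteq> i \<and> adj i j} = ({..<V} - {i}) \<union> (\<lambda>c. c + V) ` {c. c < l \<and> B i c}"
    proof (intro equalityI subsetI)
      fix j assume j: "j \<in> {j. j < n \<and> j \<noteq> i \<and> adj i j}"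
      show "j \<in> ({..<V} - {i}) \<union> (\<lambda>c. c + V) ` {c. c < l \<and> B i c}"
      proof (cases "j < V")
        case False
        hence "j = (j - V) + V" "j - V < l" "B i (j - V)" using i j n by (auto simp: adj_def)
        thus ?thesis by blast
      qed (use j in auto)
    qed (use i n in \<open>auto simp: adj_def V_def\<close>)
    moreover have "card (({..<V} - {i}) \<union> (\<lambda>c. c + V) ` {c. c < l \<and> B i c}) = (V - 1) + x"
      using i row[of i] by (subst card_Un_disjoint) (auto simp: card_image V_def)
    ultimately show ?thesis using degG[of i] i n by (simp add: V_def)
  qed
  have deg_mid: "int k \<le> deg G i \<and> deg G i \<le> int (V - 1)" if i: "k \<le> i" "i < V" for i
  proof -
    let ?N = "{j. j < n \<and> j \<noteq> i \<and> adj i j}"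
    have "{..<k} \<subseteq> ?N" "?N \<subseteq> {..<V} - {i}" using i n by (auto simp: adj_def V_def)
    from card_mono[OF _ this(1)] card_mono[OF _ this(2)] show ?thesis
      using degG[of i] i n by simp
  qed
  have deg_indep: "deg G i = int (card {j. j < k \<and> B j (i - V)})" if i: "V \<le> i" "i < n" for i
  proof -
    have "{j. j < n \<and> j \<noteq> i \<and> adj i j} = {j. j < k \<and> B j (i - V)}"
      using i n by (auto simp: adj_def V_def)
    thus ?thesis using degG[of i] i by simp
  qed
  have deg_indep_le: "deg G i \<le> int k" if "V \<le> i" "i < n" for i
  proof -
    have "card {j. j < k \<and> B j (i - V)} \<le> card {..<k}" by (rule card_mono) auto
    thus ?thesis using deg_indep[OF that] by simp
  qed
  have deg_anti: "deg G j \<le> deg G i" if ij: "i < j" "j < n" for i j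
  proof -
    consider "j < k" | "i < k" "k \<le> j" "j < V" | "k \<le> i" "j < V" | "i < V" "V \<le> j" | "V \<le> i"
      by linarith
    thus ?thesis
    proof cases
      case 1
      thus ?thesis using deg_clique ij by simp
    next
      case 2
      thus ?thesis using deg_clique[of i] deg_mid[of j] by simp
    next
      case 3
      \<comment> \<open>Neighbourhoods in a threshold graph are nested, so \<open>j\<close> has no
        private neighbour.\<close>
      show ?thesis
      proof (rule ccontr)
        assume "\<not> ?thesis"
        then obtain u where u: "u < n" "u \<noteq> i" "u \<noteq> j" "{j, u} \<in> G" "{i, u} \<notin> G"
          using ex_private_neighbour[OF G ij(2), of i] by auto
        thus False using 3 ij by (auto simp: inG adj_def split: if_splits)
      qed
    next
      case 4
      have "int k \<le> deg G i"
        using deg_clique[of i] deg_mid[of i] 4 m by (cases "i < k") (auto simp: V_def)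
      thus ?thesis using deg_indep_le[of j] 4 ij by simp
    next
      case 5
      thus ?thesis using anti[of "i - V" "j - V"] deg_indep ij n by simp
    qed
  qed
  have deg_range: "int lo \<le> deg G i \<and> deg G i \<le> int hi" if i: "i < n" for i
  proof -
    have V: "int k \<le> int (V - 1 + x)" "int (V - 1 + x) \<le> int hi" "int k \<le> int hi"
      using hi m by (auto simp: V_def)
    consider "i < k" | "k \<le> i" "i < V" | "V \<le> i" by linarith
    thus ?thesis
    proof cases
      case 1
      thus ?thesis using deg_clique V lo by simp
    next
      case 2
      thus ?thesis using deg_mid[OF 2] V lo by simp
    next
      case 3
      have "lo \<le> card {j. j < k \<and> B j (i - V)}"
        by (rule lower) (use lo 3 i in \<open>auto simp: V_def l_def\<close>)
      thus ?thesis using deg_indep_le[OF 3 i] deg_indep[OF 3 i] V(3) by linarith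
    qed
  qed
  define D where "D = map (deg G) [0..<n]"
  have lenD: "length D = n" and nthD: "\<And>i. i < n \<Longrightarrow> D ! i = deg G i" by (simp_all add: D_def)
  have "G \<in> realizations D" using G by (simp add: realizations_altdef lenD nthD)
  hence graphic: "graphic D" by (auto simp: graphic_def)
  have "sum_list D = (\<Sum>i<n. deg G i)"
    by (simp add: D_def sum_list_distinct_conv_sum_set atLeast0LessThan)
  hence "even (sum_list D)" using even_sum_deg[OF G] by simp
  hence box: "D \<in> degree_box n (int hi) (int lo)"
    using deg_anti deg_range
    by (auto simp: degree_box_def lenD sorted_wrt_iff_nth_less nthD) (auto simp: D_def)
  \<comment> \<open>The middle weights fall in steps of 4 from \<open>4 * m - 1\<close> to
    \<open>3 - 4 * m\<close>. Two of them add up to 2 modulo 4, never zero, with positive sum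
    exactly when adjacent; only pairs between the clique and the independent set have weight
    zero.\<close>
  define w :: "nat \<Rightarrow> int" where
    "w = (\<lambda>i. if i < k then 4 * int m
      else if i < V then 4 * int m - 1 - 4 * (int i - int k) else - 4 * int m)"
  have pos: "{i, j} \<in> G" if "i < j" "j < n" "0 < w i + w j" for i j
    using that by (auto simp: inG adj_def w_def V_def split: if_splits)
  have neg: "{i, j} \<notin> G" if "i < j" "j < n" "w i + w j < 0" for i j
    using that by (auto simp: inG adj_def w_def V_def split: if_splits)
  define a where "a = (\<lambda>p. k + p)"
  define b where "b = (\<lambda>q. V - 1 - q)"
  have "2 ^ r \<le> pp D"
  proof (rule half_graph_pp[OF graphic, where a = a and b = b])
    fix p q assume "p < 2 * r + 1" "q < 2 * r + 1"
    hence pq: "p < m" "q < m" by (auto simp: m_def)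
    show less: "a p < b q" using pq by (auto simp: a_def b_def V_def)
    fix E assume E: "E \<in> realizations D"
    have "w (a p) + w (b q) = 2 + 4 * (int q - int p)"
      using pq by (simp add: w_def a_def b_def V_def)
    hence "w (a p) + w (b q) \<noteq> 0" by presburger
    moreover have "b q < n" using pq n by (simp add: b_def V_def)
    ultimately have "{a p, b q} \<in> E \<longleftrightarrow> {a p, b q} \<in> G"
      using E less
      by (intro forced_pairs[OF G _ _ pos neg]) (auto simp: realizations_altdef lenD nthD)
    also have "\<dots> \<longleftrightarrow> p \<le> q"
      using pq less \<open>b q < n\<close> by (auto simp: inG adj_def a_def b_def V_def)
    finally show "{a p, b q} \<in> E \<longleftrightarrow> p \<le> q" .
  qed (use n in \<open>auto simp: lenD a_def b_def V_def m_def inj_on_def\<close>)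
  with box graphic show ?thesis by blast
qed

section \<open>P-stability\<close>

lemma finite_degree_box: "finite (degree_box n c1 c2)"
proof (rule finite_subset)
  show "degree_box n c1 c2 \<subseteq> {D. set D \<subseteq> {c2..c1} \<and> length D = n}"
    by (auto simp: degree_box_def)
qed (simp add: finite_lists_length_eq)

lemma nongraphic_inner_box:
  fixes n f g h r :: nat
  assumes D: "D \<in> degree_box n (int g - int h) (int f + int h)" and ng: "\<not> graphic D"
    and fh: "f + h < n" and r: "4 * r + 2 \<le> h"
  shows "\<exists>D'\<in>degree_box n (int g) (int f). graphic D' \<and> 2 ^ r \<le> pp D'"
proof (cases "n \<le> g + 1")
  case True
  \<comment> \<open>The upper bound \<open>g\<close> cannot bind here, so no independent set is
    needed.\<close>
  show ?thesis
    by (rule half_graph_in_box[where k = "n - 2 * (2 * r + 1)" and x = 0]) (use True fh r in auto)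
next
  case False
  have len: "length D = n" and bounds: "\<And>i. i < n \<Longrightarrow> int f + int h \<le> D ! i \<and> D ! i \<le> int g - int h"
    using D by (auto simp: degree_box_def)
  have "\<forall>d\<in>set D. 0 \<le> d" using D by (auto simp: degree_box_def)
  then obtain k where k: "1 \<le> k" "k \<le> n"
    and EG: "int k * (int k - 1) + (\<Sum>s = k..<n. min (int k) (D ! s)) < (\<Sum>i<k. D ! i)"
    using erdos_gallai[of D] D ng len by (auto simp: degree_box_def)
  have "(\<Sum>i<k. D ! i) \<le> (\<Sum>i<k. int g - int h)"
    by (rule sum_mono) (use bounds k in auto)
  moreover have "(\<Sum>s = k..<n. min (int k) (int f + int h)) \<le> (\<Sum>s = k..<n. min (int k) (D ! s))"
    by (rule sum_mono) (use bounds in \<open>auto simp: min_le_iff_disj\<close>)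
  ultimately have "int k * (int k - 1) + int (n - k) * min (int k) (int f + int h)
      < int k * (int g - int h)"
    using EG by simp
  hence main: "int (n - k) * min (int k) (int f + int h) < int k * (int g - int h - int k + 1)"
    by (simp add: algebra_simps)
  \<comment> \<open>Otherwise the minimum is \<open>k\<close>, and cancelling it leaves
    \<open>n \<le> g - h\<close>.\<close>
  have kf: "f + h < k"
  proof (rule ccontr)
    assume "\<not> ?thesis"
    hence "int (n - k) * int k < int k * (int g - int h - int k + 1)" using main by simp
    hence "int k * int (n - k) < int k * (int g - int h - int k + 1)" by (simp add: mult.commute)
    hence "int (n - k) < int g - int h - int k + 1" using k by (simp add: mult_less_cancel_left)
    thus False using False k by simp
  qed
  hence main': "int (n - k) * (int f + int h) < int k * (int g - int h - int k + 1)"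
    using main by simp
  have kg: "k + h \<le> g"
  proof (rule ccontr)
    assume "\<not> ?thesis"
    hence "int k * (int g - int h - int k + 1) \<le> 0" by (intro mult_nonneg_nonpos) auto
    thus False using main' by (smt (verit) mult_nonneg_nonneg of_nat_0_le_iff)
  qed
  define m where "m = 2 * r + 1"
  define l where "l = n - (k + 2 * m)"
  \<comment> \<open>The largest row size allowed by the \<open>l\<close> columns and by the degree
    bound \<open>k + 2 * m - 1 + x \<le> g\<close>.\<close>
  define x where "x = min l (g + 1 - (k + 2 * m))"
  have m: "2 * m \<le> h" using r by (simp add: m_def)
  have "f * l \<le> k * x"
  proof (cases "x = l")
    case True
    thus ?thesis using kf by simp
  next
    case False
    \<comment> \<open>The margin \<open>h\<close> pays for the \<open>2 * m\<close> extra vertices: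
      \<open>x = g + 1 - k - 2 * m \<ge> g - h - k + 1\<close>.\<close>
    hence "int k * (int g - int h - int k + 1) \<le> int k * int x"
      using m kg by (intro mult_left_mono) (auto simp: x_def min_def)
    moreover have "int l * int f \<le> int (n - k) * (int f + int h)"
      by (intro mult_mono) (auto simp: l_def)
    ultimately have "int (f * l) \<le> int (k * x)" using main' by (simp add: mult.commute)
    thus ?thesis by linarith
  qed
  thus ?thesis
    by (intro half_graph_in_box[where k = k and x = x])
      (use False kg kf m in \<open>auto simp: m_def l_def x_def\<close>)
qed

section \<open>Comparison of \<open>h\<close> with polynomials\<close>

lemma poly_le_power_degree:
  fixes p :: "real poly"
  obtains A where "A \<ge> 1" "\<And>x. x \<ge> 1 \<Longrightarrow> poly p x \<le> A * x ^ degree p"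
proof
  let ?A = "1 + (\<Sum>i\<le>degree p. \<bar>coeff p i\<bar>)"
  show "?A \<ge> 1" by (simp add: sum_nonneg)
  fix x :: real assume x: "x \<ge> 1"
  have "poly p x = (\<Sum>i\<le>degree p. coeff p i * x ^ i)" by (rule poly_altdef)
  also have "\<dots> \<le> (\<Sum>i\<le>degree p. \<bar>coeff p i\<bar> * x ^ degree p)"
    using x by (intro sum_mono mult_mono power_increasing) auto
  also have "\<dots> \<le> ?A * x ^ degree p"
    using x by (simp add: sum_distrib_right distrib_right)
  finally show "poly p x \<le> ?A * x ^ degree p" .
qed

lemma superlogarithmic_imp_superpolynomial:
  fixes h :: "nat \<Rightarrow> nat" and p :: "real poly"
  assumes lim: "filterlim (\<lambda>n. real (h n) / ln (real n)) at_top sequentially"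
  shows "\<forall>\<^sub>F n in sequentially. 2 \<le> h n \<and> poly p (real n) < 2 ^ ((h n - 2) div 4)"
proof -
  obtain A where A: "A \<ge> 1" "\<And>x. x \<ge> 1 \<Longrightarrow> poly p x \<le> A * x ^ degree p"
    using poly_le_power_degree[of p] by blast
  define d where "d = real (degree p)"
  \<comment> \<open>With \<open>h n \<ge> C * ln n\<close>, the power \<open>2 ^ (h n / 4)\<close>
    is at least \<open>n ^ (d + 1)\<close>; the spare factor \<open>n\<close> absorbs
    \<open>A\<close> and the rounding in the exponent.\<close>
  define C where "C = 4 * (d + 1) / ln 2"
  have ln2: "0 < ln (2::real)" "ln (2::real) \<le> 1" using ln_le_minus_one[of "2::real"] by simp_all
  have d: "0 \<le> d" by (simp add: d_def)
  have "\<forall>\<^sub>F n in sequentially. C \<le> real (h n) / ln (real n)"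
    using lim by (simp add: filterlim_at_top)
  moreover have "\<forall>\<^sub>F n in sequentially. 2 + ln A < ln (real n)"
    using filterlim_compose[OF ln_at_top filterlim_real_sequentially]
    by (simp add: filterlim_at_top_dense)
  ultimately show ?thesis
  proof eventually_elim
    case (elim n)
    have lnn: "2 < ln (real n)" using elim(2) A(1) ln_ge_zero[of A] by linarith
    have "n > 0" using lnn by (cases n) auto
    have h: "C * ln (real n) \<le> real (h n)"
      using elim(1) lnn by (simp add: pos_le_divide_eq)
    have "4 \<le> C" using ln2 d by (simp add: C_def pos_le_divide_eq)
    hence "4 * 2 \<le> C * ln (real n)" using lnn by (intro mult_mono) auto
    hence h2: "8 \<le> h n" using h by linarith
    define r where "r = (h n - 2) div 4"
    have "real (h n) \<le> 4 * real r + 5" unfolding r_def using h2 by linarith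
    hence "ln 2 * (C * ln (real n)) \<le> ln 2 * (4 * real r + 5)"
      using h ln2 by (intro mult_left_mono) auto
    hence "4 * (d + 1) * ln (real n) \<le> ln 2 * (4 * real r + 5)"
      using ln2 by (simp add: C_def)
    hence "ln A + d * ln (real n) < ln 2 * real r"
      using ln2 elim(2) by (simp add: algebra_simps)
    hence "ln (A * real n ^ degree p) < ln (2 ^ r)"
      using A(1) \<open>n > 0\<close> by (simp add: ln_mult ln_realpow d_def mult.commute)
    hence "A * real n ^ degree p < 2 ^ r" using A(1) \<open>n > 0\<close> by (subst (asm) ln_less_cancel_iff) auto
    thus ?case using A(2)[of "real n"] h2 \<open>n > 0\<close> by (simp add: r_def)
  qed
qed

theorem theorem5p10:
  fixes f g h :: "nat \<Rightarrow> nat"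
  assumes "mono f" and "mono g" and "mono h"
    and P_stable: "P_stable (degree_region (\<lambda>n. int (f n)) (\<lambda>n. int (g n)))"
    and slow: "\<forall>n k. f (n + k) \<le> f n + k"
    and lim: "filterlim (\<lambda>n. real (h n) / ln (real n)) at_top sequentially"
    and degree_range: "\<forall>\<^sub>F n in sequentially.
      degree_box n (int (g n) - int (h n)) (int (f n) + int (h n)) \<noteq> {} \<longrightarrow> f n + h n < n"
  shows "almost_fully_graphic
    (degree_region (\<lambda>n. int (f n) + int (h n)) (\<lambda>n. int (g n) - int (h n)))"
proof -
  obtain p :: "real poly" where p: "\<And>D n. D \<in> degree_box n (int (g n)) (int (f n)) \<Longrightarrow>
      graphic D \<Longrightarrow> pp D \<le> poly p (real (length D))"
    using P_stable by (force simp: P_stable_def degree_region_def)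
  let ?B = "\<lambda>n. degree_box n (int (g n) - int (h n)) (int (f n) + int (h n))"
  from superlogarithmic_imp_superpolynomial[OF lim, of p] degree_range
  have "\<forall>\<^sub>F n in sequentially. \<forall>D\<in>?B n. graphic D"
  proof eventually_elim
    case (elim n)
    show ?case
    proof (rule ballI, rule ccontr)
      fix D assume D: "D \<in> ?B n" and ng: "\<not> graphic D"
      have "f n + h n < n" using elim(2) D by auto
      \<comment> \<open>This is the largest \<open>r\<close> with
        \<open>4 * r + 2 \<le> h n\<close>; the bound \<open>2 \<le> h n\<close> keeps the
        subtraction from truncating.\<close>
      moreover have "4 * ((h n - 2) div 4) + 2 \<le> h n" using elim(1) by linarith
      ultimately obtain D' where D': "D' \<in> degree_box n (int (g n)) (int (f n))" "graphic D'"
        and "2 ^ ((h n - 2) div 4) \<le> pp D'"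
        using nongraphic_inner_box[OF D ng] by blast
      moreover have "length D' = n" using D'(1) by (simp add: degree_box_def)
      ultimately show False using p[OF D'] elim(1) by simp
    qed
  qed
  then obtain N where N: "\<And>n D. N \<le> n \<Longrightarrow> D \<in> ?B n \<Longrightarrow> graphic D"
    by (auto simp: eventually_sequentially)
  \<comment> \<open>The exceptional set consists of all boxes below the threshold.\<close>
  have "finite (\<Union>n<N. ?B n)" by (simp add: finite_degree_box)
  moreover have "fully_graphic (degree_region (\<lambda>n. int (f n) + int (h n))
      (\<lambda>n. int (g n) - int (h n)) - (\<Union>n<N. ?B n))"
    unfolding fully_graphic_def
  proof
    fix D assume D: "D \<in> degree_region (\<lambda>n. int (f n) + int (h n)) (\<lambda>n. int (g n) - int (h n))
      - (\<Union>n<N. ?B n)"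
    then obtain n where "D \<in> ?B n" by (auto simp: degree_region_def)
    moreover from this have "N \<le> n" using D by (meson DiffE UN_I lessThan_iff not_le_imp_less)
    ultimately show "graphic D" using N by blast
  qed
  ultimately show ?thesis unfolding almost_fully_graphic_def by blast
qed

end
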